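(* Let $n\ge1$, $p\in(-1/n,0)$, and let $q<0$ be given by $\frac1q=\frac1p+n$. Let $w:\mathbb{R}^n\setminus\{0\}\to\mathbb{R}_+$ be a $p$-homogeneous Borel function and let $\mu=w(x)\,dx$. Let $\|\cdot\|_K$ be an arbitrary semi-norm on $\mathbb{R}^n$ with open unit ball $K$ such that $\mu(\mathbb{R}^n\setminus K)<\infty$. Then for every Borel set $C\subset\mathbb{R}^n$ with $\mu(C)<\infty$, $$\mu^-_{\|\cdot\|_K}(C)\ \ge\ -\frac1q\,\mu(\mathbb{R}^n\setminus K)^q\,\mu(C)^{1-q},$$ with equality for $C=\mathbb{R}^n\setminus tK$, $t>0$. In other words, complements of homothetic copies of $K$ are isoperimetric minimizers for $(\mathbb{R}^n,\|\cdot\|_K,\mu)$.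
   Context: Semi-norms need not be symmetric: a semi-norm is a subadditive function $\|\cdot\|:\mathbb{R}^n\to[0,\infty)$ with $\|\lambda x\|=\lambda\|x\|$ for all $\lambda\ge0$; its open unit ball is $K=\{x:\|x\|_K<1\}$. $w$ is $p$-homogeneous if $w(\lambda x)^p=\lambda w(x)^p$ (equivalently, for $p<0$, $w(\lambda x)=\lambda^{1/p}w(x)$) for all $x\neq0$, $\lambda>0$. Inner Minkowski boundary measure: $\mu^-_{\|\cdot\|_K}(C)=\liminf_{\epsilon\to0^+}\frac{\mu((A+\epsilon K)\setminus A)}{\epsilon}$ with $A=\mathbb{R}^n\setminus C$, where $A+\epsilon K$ is the Minkowski sum. Conventions: $0^q=\infty$ for $q<0$, and $\infty\cdot0=0$. *)

theory Defs
  imports "HOL-Analysis.Analysis" "HOL-Library.Set_Algebras"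
begin

text \<open>
  Real powers on $[0,\infty]$, with $0^a = \infty$ and $\infty^a = 0$ for $a < 0$.
  The convention $\infty \cdot 0 = 0$ is the one built into \<^typ>\<open>ennreal\<close>.
\<close>

definition epow :: "ennreal \<Rightarrow> real \<Rightarrow> ennreal" where
  "epow x a =
    (if a = 0 then 1
     else if x = \<infinity> then (if a < 0 then 0 else \<infinity>)
     else if x = 0 \<and> a < 0 then \<infinity>
     else ennreal (enn2real x powr a))"

text \<open>Semi-norms are not required to be symmetric.\<close>

definition semi_norm :: "('a::real_vector \<Rightarrow> real) \<Rightarrow> bool" where
  "semi_norm N \<longleftrightarrow>
    (\<forall>x. 0 \<le> N x) \<and>
    (\<forall>x y. N (x + y) \<le> N x + N y) \<and>
    (\<forall>c x. 0 \<le> c \<longrightarrow> N (c *\<^sub>R x) = c * N x)"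

definition open_unit_ball :: "('a \<Rightarrow> real) \<Rightarrow> 'a set" where
  "open_unit_ball N = {x. N x < 1}"

definition p_homogeneous :: "real \<Rightarrow> ('a::real_vector \<Rightarrow> real) \<Rightarrow> bool" where
  "p_homogeneous p w \<longleftrightarrow>
    (\<forall>x c. x \<noteq> 0 \<longrightarrow> 0 < c \<longrightarrow>
      epow (ennreal (w (c *\<^sub>R x))) p = ennreal c * epow (ennreal (w x)) p)"

text \<open>
  The measure $w(x)\,dx$. The weight is a function on the punctured space; the value that the
  total function \<open>w\<close> takes at the origin is irrelevant.
\<close>

definition weighted_measure :: "('a::euclidean_space \<Rightarrow> real) \<Rightarrow> 'a measure" where
  "weighted_measure w = density lborel (\<lambda>x. if x = 0 then 0 else ennreal (w x))"

definition inner_minkowski ::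
    "'a::euclidean_space measure \<Rightarrow> ('a \<Rightarrow> real) \<Rightarrow> 'a set \<Rightarrow> ennreal" where
  "inner_minkowski \<mu> N C =
    (let A = - C; K = open_unit_ball N in
      Liminf (at_right 0)
        (\<lambda>\<epsilon>::real. emeasure \<mu> ((A + (\<lambda>x. \<epsilon> *\<^sub>R x) ` K) - A) / ennreal \<epsilon>))"

definition isoperimetric_minimizer ::
    "'a::euclidean_space measure \<Rightarrow> ('a \<Rightarrow> real) \<Rightarrow> 'a set \<Rightarrow> bool" where
  "isoperimetric_minimizer \<mu> N C \<longleftrightarrow>
    C \<in> sets borel \<and>
    (\<forall>D \<in> sets borel. emeasure \<mu> D = emeasure \<mu> C \<longrightarrow>
      inner_minkowski \<mu> N C \<le> inner_minkowski \<mu> N D)"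

end

theory Submission
  imports Defs
begin

text \<open>
  Write \<open>\<alpha> = 1 / q < 0\<close> and \<open>B t = {N \<ge> t}\<close>. Homogeneity of \<open>w\<close> says \<open>\<mu> (c E) = c\<^sup>\<alpha> \<mu> E\<close>, so in polar
  coordinates \<open>\<mu>\<close> has density \<open>l\<^sup>\<alpha>\<^sup>-\<^sup>1 dl\<close> on each ray. Let \<open>A\<close> be the complement of \<open>C\<close>. If \<open>x\<close> lies
  outside \<open>A + \<epsilon>K\<close> and \<open>s < \<epsilon>\<close>, then \<open>(1 - s / N x) x\<close> lies in \<open>C\<close>, and integrating along rays gives
  \<open>\<mu> (C - (A + \<epsilon>K)) \<le> \<integral>\<^sub>C (1 + s / N)\<^sup>\<alpha>\<^sup>-\<^sup>1 d\<mu>\<close>, with equality when \<open>C = B t\<close> and \<open>\<epsilon> = s\<close>. The integrand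
  increases with \<open>N\<close>, so by the bathtub principle the right-hand side is largest, among sets of
  measure \<open>\<mu> (B t)\<close>, for \<open>B t\<close> itself. Hence \<open>\<mu> (C - (A + \<epsilon>K)) \<le> \<mu> (B (t + \<epsilon>))\<close> for every \<open>\<epsilon> > 0\<close>,
  which is the isoperimetric inequality before passing to the limit.
\<close>

section \<open>Analytic preliminaries: continuity, scaling, the bathtub principle, integrals along a
  ray\<close>

lemma semi_norm_continuous_on:
  fixes N :: "'a::euclidean_space \<Rightarrow> real"
  assumes "semi_norm N"
  shows "continuous_on A N"
proof -
  \<comment> \<open>Subadditivity and positive homogeneity give convexity, and a real-valued convex
    function on a Euclidean space is continuous.\<close>
  have "convex_on UNIV N"
    using assms unfolding convex_on_def semi_norm_def by (metis convex_UNIV)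
  then have "continuous_on UNIV N"
    by (intro convex_on_continuous) auto
  then show ?thesis
    by (rule continuous_on_subset) auto
qed

lemma nn_integral_lborel_scaleR:
  fixes F :: "'a::euclidean_space \<Rightarrow> ennreal"
  assumes [measurable]: "F \<in> borel_measurable borel" and c: "0 < c"
  shows "(\<integral>\<^sup>+x. F x \<partial>lborel) = ennreal (c ^ DIM('a)) * (\<integral>\<^sup>+x. F (c *\<^sub>R x) \<partial>lborel)"
proof -
  have "(\<integral>\<^sup>+x. F x \<partial>lborel)
      = (\<integral>\<^sup>+x. F x \<partial>density (distr lborel borel (\<lambda>x. 0 + c *\<^sub>R x)) (\<lambda>_. ennreal (\<bar>c\<bar> ^ DIM('a))))"
    using lborel_affine[of c "0::'a"] c by simp
  also have "\<dots> = ennreal (c ^ DIM('a)) * (\<integral>\<^sup>+x. F (c *\<^sub>R x) \<partial>lborel)"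
    using c by (simp add: nn_integral_density nn_integral_distr nn_integral_cmult)
  finally show ?thesis .
qed

text \<open>The common part \<open>D \<inter> B\<close> contributes equally to both sides. Of the
  rests, \<open>D - B\<close> has the smaller measure and \<open>\<phi>\<close> at most
  \<open>k\<close>, while \<open>\<phi>\<close> is at least \<open>k\<close> on
  \<open>B - D\<close>. Comparing the rests cancels the measure of the intersection, which is where
  finiteness enters.\<close>

lemma nn_integral_bathtub:
  assumes [measurable]: "D \<in> sets M" "B \<in> sets M" "\<phi> \<in> borel_measurable M"
    and fin: "emeasure M D < \<infinity>" and le: "emeasure M D \<le> emeasure M B"
    and D: "\<And>x. x \<in> D - B \<Longrightarrow> \<phi> x \<le> k" and B: "\<And>x. x \<in> B \<Longrightarrow> k \<le> \<phi> x"
  shows "(\<integral>\<^sup>+x. \<phi> x * indicator D x \<partial>M) \<le> (\<integral>\<^sup>+x. \<phi> x * indicator B x \<partial>M)"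
proof -
  have fin': "emeasure M (D \<inter> B) \<noteq> \<infinity>"
    using emeasure_mono[of "D \<inter> B" D M] fin by (auto simp: top_unique)
  have "emeasure M (D - B) + emeasure M (D \<inter> B) = emeasure M D"
    by (subst plus_emeasure) (auto intro!: arg_cong2[where f = emeasure])
  moreover have "emeasure M (B - D) + emeasure M (D \<inter> B) = emeasure M B"
    by (subst plus_emeasure) (auto intro!: arg_cong2[where f = emeasure])
  ultimately have diff: "emeasure M (D - B) \<le> emeasure M (B - D)"
    using le fin' by (metis add.commute ennreal_add_left_cancel_le infinity_ennreal_def)
  have split: "(\<integral>\<^sup>+x. \<phi> x * indicator X x \<partial>M)
      = (\<integral>\<^sup>+x. \<phi> x * indicator (X - Y) x \<partial>M) + (\<integral>\<^sup>+x. \<phi> x * indicator (X \<inter> Y) x \<partial>M)"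
    if [measurable]: "X \<in> sets M" "Y \<in> sets M" for X Y
    by (subst nn_integral_add[symmetric])
       (auto intro!: nn_integral_cong simp: indicator_def)
  have "(\<integral>\<^sup>+x. \<phi> x * indicator (D - B) x \<partial>M) \<le> (\<integral>\<^sup>+x. k * indicator (D - B) x \<partial>M)"
    by (intro nn_integral_mono) (auto simp: indicator_def D)
  also have "\<dots> = k * emeasure M (D - B)"
    by (simp add: nn_integral_cmult_indicator)
  also have "\<dots> \<le> k * emeasure M (B - D)"
    by (intro mult_left_mono diff) auto
  also have "\<dots> = (\<integral>\<^sup>+x. k * indicator (B - D) x \<partial>M)"
    by (simp add: nn_integral_cmult_indicator)
  also have "\<dots> \<le> (\<integral>\<^sup>+x. \<phi> x * indicator (B - D) x \<partial>M)"
    by (intro nn_integral_mono) (auto simp: indicator_def B)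
  finally show ?thesis
    unfolding split[OF assms(1,2)] split[OF assms(2,1)] by (simp add: Int_commute add_right_mono)
qed

text \<open>The indicators confine \<open>l\<close> to the interval from \<open>r / exp 1\<close> to
  \<open>r\<close>, on which \<open>1 / l\<close> integrates to \<open>ln (exp 1) = 1\<close>. The
  ratio \<open>exp 1\<close> is chosen to make this mass 1 for every \<open>r\<close>.\<close>

lemma nn_integral_inverse_dilations:
  fixes r :: real
  assumes r: "0 < r"
  shows "(\<integral>\<^sup>+l. indicator {0<..} l * indicator {1..exp 1} (r / l) * ennreal (1 / l) \<partial>lborel) = 1"
proof -
  have "(\<integral>\<^sup>+l. indicator {0<..} l * indicator {1..exp 1} (r / l) * ennreal (1 / l) \<partial>lborel)
      = (\<integral>\<^sup>+l. ennreal (1 / l) * indicator {r / exp 1..r} l \<partial>lborel)"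
  proof (intro nn_integral_cong)
    fix l :: real
    show "indicator {0<..} l * indicator {1..exp 1} (r / l) * ennreal (1 / l)
        = ennreal (1 / l) * indicator {r / exp 1..r} l"
    proof (cases "0 < l")
      case True
      then show ?thesis by (auto simp: indicator_def field_simps)
    next
      case False
      then have "l < r / exp 1" using r by (intro order.strict_trans1[of l 0]) auto
      then show ?thesis using False by (simp add: indicator_def)
    qed
  qed
  also have "\<dots> = ennreal (ln r - ln (r / exp 1))"
    using r by (intro nn_integral_FTC_Icc)
      (auto intro!: derivative_eq_intros simp: divide_le_eq field_simps
         intro: order.strict_trans2[of 0 "r / exp 1"] less_imp_le[OF order.strict_trans2[of 0 "r / exp 1"]])
  also have "\<dots> = 1"
    using r by (simp add: ln_div)
  finally show ?thesis .
qed

section \<open>Scaling and polar coordinates for a homogeneous density\<close>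

locale homogeneous_weight =
  fixes W :: "'a::euclidean_space \<Rightarrow> ennreal" and N :: "'a \<Rightarrow> real" and \<alpha> :: real
  assumes W_measurable [measurable]: "W \<in> borel_measurable borel"
    and W_scaleR: "\<And>c x. 0 < c \<Longrightarrow> W (c *\<^sub>R x) = ennreal (c powr (\<alpha> - DIM('a))) * W x"
    and semi_norm: "semi_norm N"
    and \<alpha>_neg: "\<alpha> < 0"
begin

abbreviation \<mu> :: "'a measure" where
  "\<mu> \<equiv> density lborel W"

text \<open>For \<open>0 < t\<close> this is the complement of \<open>t K\<close>, where
  \<open>K\<close> is the open unit ball of \<open>N\<close>.\<close>

definition B :: "real \<Rightarrow> 'a set" where
  "B t = {x. t \<le> N x}"

lemma N_nonneg: "0 \<le> N x"
  and N_add: "N (x + y) \<le> N x + N y"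
  and N_scaleR: "0 \<le> c \<Longrightarrow> N (c *\<^sub>R x) = c * N x"
  using semi_norm by (auto simp: semi_norm_def)

lemma N_measurable [measurable]: "N \<in> borel_measurable borel"
  by (intro borel_measurable_continuous_onI semi_norm_continuous_on semi_norm)

lemma B_measurable [measurable]: "B t \<in> sets borel"
  unfolding B_def by measurable

text \<open>With \<open>n = DIM('a)\<close>, the substitution contributes the Jacobian
  \<open>c ^ n\<close> and the weight contributes \<open>c powr (\<alpha> - n)\<close>; together
  they leave \<open>c powr \<alpha>\<close>. In the application \<open>\<alpha> - n\<close> is
  \<open>1 / p\<close>.\<close>

lemma nn_integral_scaleR:
  assumes [measurable]: "F \<in> borel_measurable borel" and c: "0 < c"
  shows "(\<integral>\<^sup>+x. W x * F (c *\<^sub>R x) \<partial>lborel) = ennreal (c powr - \<alpha>) * (\<integral>\<^sup>+x. W x * F x \<partial>lborel)"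
proof -
  have "(\<integral>\<^sup>+x. W x * F x \<partial>lborel)
      = ennreal (c ^ DIM('a)) * (\<integral>\<^sup>+x. W (c *\<^sub>R x) * F (c *\<^sub>R x) \<partial>lborel)"
    by (rule nn_integral_lborel_scaleR) (use c in auto)
  also have "\<dots> = ennreal (c ^ DIM('a)) * (ennreal (c powr (\<alpha> - DIM('a)))
      * (\<integral>\<^sup>+x. W x * F (c *\<^sub>R x) \<partial>lborel))"
    using c by (simp add: W_scaleR nn_integral_cmult mult.assoc)
  also have "\<dots> = ennreal (c powr \<alpha>) * (\<integral>\<^sup>+x. W x * F (c *\<^sub>R x) \<partial>lborel)"
    using c by (simp add: mult.assoc[symmetric] ennreal_mult[symmetric] powr_realpow[symmetric]
        powr_add[symmetric])
  finally show ?thesis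
    using c by (simp add: mult.assoc[symmetric] ennreal_mult[symmetric] powr_add[symmetric])
qed

lemma emeasure_scaleR:
  assumes [measurable]: "E \<in> sets borel" and c: "0 < c"
  shows "emeasure \<mu> ((\<lambda>x. c *\<^sub>R x) -` E) = ennreal (c powr - \<alpha>) * emeasure \<mu> E"
proof -
  have [measurable]: "(\<lambda>x. c *\<^sub>R x) -` E \<in> sets borel"
    using measurable_sets[of "\<lambda>x::'a. c *\<^sub>R x" borel borel E] by simp
  show ?thesis
    using nn_integral_scaleR[of "indicator E" c] c
    by (simp add: emeasure_density indicator_def vimage_def)
qed

text \<open>
  Polar coordinates without a surface measure: the shell \<open>1 \<le> N \<le> e\<close> plays the role of the
  unit sphere, and every ray crosses it in a set of mass \<open>1\<close> for the dilation-invariant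
  measure \<open>dl / l\<close>.
\<close>

lemma nn_integral_polar:
  assumes [measurable]: "F \<in> borel_measurable borel"
  shows "(\<integral>\<^sup>+x. W x * (F x * indicator {x. 0 < N x} x) \<partial>lborel)
    = (\<integral>\<^sup>+x. W x * indicator {1..exp 1} (N x)
        * (\<integral>\<^sup>+l. indicator {0<..} l * ennreal (l powr (\<alpha> - 1)) * F (l *\<^sub>R x) \<partial>lborel) \<partial>lborel)"
proof -
  let ?i = "indicator {0<..} :: real \<Rightarrow> ennreal"
  let ?S = "indicator {1..exp 1} :: real \<Rightarrow> ennreal"
  have "(\<integral>\<^sup>+x. W x * ?S (N x) * (\<integral>\<^sup>+l. ?i l * ennreal (l powr (\<alpha> - 1)) * F (l *\<^sub>R x) \<partial>lborel) \<partial>lborel)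
      = (\<integral>\<^sup>+x. \<integral>\<^sup>+l. W x * ?S (N x) * (?i l * ennreal (l powr (\<alpha> - 1)) * F (l *\<^sub>R x)) \<partial>lborel \<partial>lborel)"
    by (intro nn_integral_cong nn_integral_cmult[symmetric]) measurable
  also have "\<dots> = (\<integral>\<^sup>+l. \<integral>\<^sup>+x. W x * ?S (N x) * (?i l * ennreal (l powr (\<alpha> - 1)) * F (l *\<^sub>R x)) \<partial>lborel \<partial>lborel)"
    by (rule lborel_pair.Fubini') measurable
  also have "\<dots> = (\<integral>\<^sup>+l. \<integral>\<^sup>+x. W x * F x * (?i l * ?S (N x / l) * ennreal (1 / l)) \<partial>lborel \<partial>lborel)"
  proof (rule nn_integral_cong)
    fix l :: real
    show "(\<integral>\<^sup>+x. W x * ?S (N x) * (?i l * ennreal (l powr (\<alpha> - 1)) * F (l *\<^sub>R x)) \<partial>lborel)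
        = (\<integral>\<^sup>+x. W x * F x * (?i l * ?S (N x / l) * ennreal (1 / l)) \<partial>lborel)"
    proof (cases "0 < l")
      case l: True
      \<comment> \<open>\<open>N x\<close> is written as \<open>N (l *\<^sub>R x) / l\<close>, so
        that apart from the weight the integrand depends on \<open>x\<close> through
        \<open>l *\<^sub>R x\<close> alone and the scaling rule applies.\<close>
      have "(\<integral>\<^sup>+x. W x * ?S (N x) * (?i l * ennreal (l powr (\<alpha> - 1)) * F (l *\<^sub>R x)) \<partial>lborel)
          = (\<integral>\<^sup>+x. ennreal (l powr (\<alpha> - 1)) * (W x * (?S (N (l *\<^sub>R x) / l) * F (l *\<^sub>R x))) \<partial>lborel)"
        using l by (intro nn_integral_cong) (simp add: N_scaleR mult_ac)
      also have "\<dots> = ennreal (l powr (\<alpha> - 1)) * (\<integral>\<^sup>+x. W x * (?S (N (l *\<^sub>R x) / l) * F (l *\<^sub>R x)) \<partial>lborel)"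
        by (rule nn_integral_cmult) measurable
      also have "\<dots> = ennreal (l powr (\<alpha> - 1)) * (ennreal (l powr - \<alpha>) * (\<integral>\<^sup>+x. W x * (?S (N x / l) * F x) \<partial>lborel))"
        using l by (subst nn_integral_scaleR[where F = "\<lambda>x. ?S (N x / l) * F x"]) auto
      also have "\<dots> = ennreal (1 / l) * (\<integral>\<^sup>+x. W x * (?S (N x / l) * F x) \<partial>lborel)"
      proof -
        have "l powr (\<alpha> - 1) * l powr - \<alpha> = 1 / l"
          using l by (simp only: powr_add[symmetric]) (simp add: powr_minus_divide)
        then show ?thesis by (simp only: mult.assoc[symmetric] ennreal_mult[symmetric] powr_ge_zero)
      qed
      also have "\<dots> = (\<integral>\<^sup>+x. W x * F x * (?i l * ?S (N x / l) * ennreal (1 / l)) \<partial>lborel)"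
        using l by (subst nn_integral_cmult[symmetric]) (auto intro!: nn_integral_cong simp: mult_ac)
      finally show ?thesis .
    qed simp
  qed
  also have "\<dots> = (\<integral>\<^sup>+x. \<integral>\<^sup>+l. W x * F x * (?i l * ?S (N x / l) * ennreal (1 / l)) \<partial>lborel \<partial>lborel)"
    by (rule lborel_pair.Fubini'[symmetric]) measurable
  also have "\<dots> = (\<integral>\<^sup>+x. W x * (F x * indicator {x. 0 < N x} x) \<partial>lborel)"
  proof (rule nn_integral_cong)
    fix x :: 'a
    have "(\<integral>\<^sup>+l. W x * F x * (?i l * ?S (N x / l) * ennreal (1 / l)) \<partial>lborel)
        = W x * F x * (\<integral>\<^sup>+l. ?i l * ?S (N x / l) * ennreal (1 / l) \<partial>lborel)"
      by (rule nn_integral_cmult) measurable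
    also have "(\<integral>\<^sup>+l. ?i l * ?S (N x / l) * ennreal (1 / l) \<partial>lborel) = indicator {x. 0 < N x} x"
      using nn_integral_inverse_dilations[of "N x"] N_nonneg[of x] by (cases "0 < N x") auto
    finally show "(\<integral>\<^sup>+l. W x * F x * (?i l * ?S (N x / l) * ennreal (1 / l)) \<partial>lborel)
        = W x * (F x * indicator {x. 0 < N x} x)"
      by (simp add: mult.assoc)
  qed
  finally show ?thesis ..
qed

text \<open>On each ray, \<open>x \<mapsto> (1 - s / N x) x\<close> is the translation towards the origin by \<open>s\<close> (in units of \<open>N\<close>).\<close>

lemma emeasure_radial_shift:
  assumes [measurable]: "D \<in> sets borel" and D: "\<And>x. x \<in> D \<Longrightarrow> 0 < N x" and s: "0 < s"
  shows "emeasure \<mu> {x. s < N x \<and> (1 - s / N x) *\<^sub>R x \<in> D}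
    = (\<integral>\<^sup>+x. ennreal ((1 + s / N x) powr (\<alpha> - 1)) * indicator D x \<partial>\<mu>)"
proof -
  let ?D' = "{x. s < N x \<and> (1 - s / N x) *\<^sub>R x \<in> D}"
  let ?\<phi> = "\<lambda>x. ennreal ((1 + s / N x) powr (\<alpha> - 1))"
  let ?i = "indicator {0<..} :: real \<Rightarrow> ennreal"
  have [measurable]: "?D' \<in> sets borel" by measurable
  have ray: "(\<integral>\<^sup>+l. ?i l * ennreal (l powr (\<alpha> - 1)) * indicator ?D' (l *\<^sub>R x) \<partial>lborel)
      = (\<integral>\<^sup>+l. ?i l * ennreal (l powr (\<alpha> - 1)) * (?\<phi> (l *\<^sub>R x) * indicator D (l *\<^sub>R x)) \<partial>lborel)"
    if x: "0 < N x" for x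
  proof -
    \<comment> \<open>On the ray through \<open>x\<close>, moving inwards by \<open>s\<close> lowers
      the parameter by \<open>a\<close>. Shifting the integration variable by \<open>a\<close> turns
      \<open>?D'\<close> into \<open>D\<close>, and the ratio of the densities,
      \<open>((a + l) / l) powr (\<alpha> - 1)\<close>, is \<open>?\<phi>\<close> at
      \<open>l *\<^sub>R x\<close>.\<close>
    define a where "a = s / N x"
    have a: "0 < a" using s x by (simp add: a_def)
    have "(\<integral>\<^sup>+l. ?i l * ennreal (l powr (\<alpha> - 1)) * indicator ?D' (l *\<^sub>R x) \<partial>lborel)
      = (\<integral>\<^sup>+l. ?i (a + l) * ennreal ((a + l) powr (\<alpha> - 1)) * indicator ?D' ((a + l) *\<^sub>R x) \<partial>lborel)"
      by (subst nn_integral_real_affine[where c = 1 and t = a]) auto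
    also have "\<dots> = (\<integral>\<^sup>+l. ?i l * ennreal (l powr (\<alpha> - 1)) * (?\<phi> (l *\<^sub>R x) * indicator D (l *\<^sub>R x)) \<partial>lborel)"
    proof (rule nn_integral_cong)
      fix l :: real
      show "?i (a + l) * ennreal ((a + l) powr (\<alpha> - 1)) * indicator ?D' ((a + l) *\<^sub>R x)
          = ?i l * ennreal (l powr (\<alpha> - 1)) * (?\<phi> (l *\<^sub>R x) * indicator D (l *\<^sub>R x))"
      proof (cases "0 < l")
        case l: True
        have al: "N ((a + l) *\<^sub>R x) = s + l * N x"
          using a l x by (simp add: N_scaleR a_def field_simps)
        have "1 - s / (s + l * N x) = l / (a + l)"
        proof -
          have "0 < s + l * N x" "0 < a + l" using s x l a by (auto intro: add_pos_pos)
          moreover have "a * N x = s" using x by (simp add: a_def)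
          ultimately show ?thesis by (simp add: field_simps)
        qed
        then have "(1 - s / N ((a + l) *\<^sub>R x)) *\<^sub>R (a + l) *\<^sub>R x = l *\<^sub>R x"
          using a l by (simp add: al)
        moreover have "s < N ((a + l) *\<^sub>R x)"
          using l x by (simp add: al)
        ultimately have "(a + l) *\<^sub>R x \<in> ?D' \<longleftrightarrow> l *\<^sub>R x \<in> D"
          by (simp only: mem_Collect_eq simp_thms)
        moreover have "(a + l) powr (\<alpha> - 1) = l powr (\<alpha> - 1) * (1 + s / N (l *\<^sub>R x)) powr (\<alpha> - 1)"
        proof -
          have "l * (1 + s / N (l *\<^sub>R x)) = a + l"
            using l x by (simp add: N_scaleR a_def field_simps)
          then show ?thesis by (simp only: powr_mult[symmetric])
        qed
        ultimately show ?thesis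
          using a l by (auto simp: indicator_def ennreal_mult)
      next
        case l: False
        \<comment> \<open>For \<open>l \<le> 0\<close> the shifted point has \<open>N\<close> at
          most \<open>s\<close> and so lies outside \<open>?D'\<close>; if even
          \<open>a + l \<le> 0\<close>, the half-line indicator vanishes.\<close>
        have "indicator ?D' ((a + l) *\<^sub>R x) = (0 :: ennreal)" if "0 < a + l"
        proof -
          have "N ((a + l) *\<^sub>R x) = s + l * N x"
            using that x by (simp add: N_scaleR a_def field_simps)
          moreover have "l * N x \<le> 0" using l x by (simp add: mult_nonpos_nonneg)
          ultimately show ?thesis by simp
        qed
        then show ?thesis using l by (auto simp: indicator_def)
      qed
    qed
    finally show ?thesis .
  qed
  have "emeasure \<mu> ?D' = (\<integral>\<^sup>+x. W x * (indicator ?D' x * indicator {x. 0 < N x} x) \<partial>lborel)"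
    using s by (auto simp: emeasure_density indicator_def intro!: nn_integral_cong)
  also have "\<dots> = (\<integral>\<^sup>+x. W x * indicator {1..exp 1} (N x)
        * (\<integral>\<^sup>+l. ?i l * ennreal (l powr (\<alpha> - 1)) * indicator ?D' (l *\<^sub>R x) \<partial>lborel) \<partial>lborel)"
    by (rule nn_integral_polar) measurable
  \<comment> \<open>The shell indicator restricts the outer integral to \<open>1 \<le> N x\<close>,
    where \<open>ray\<close> applies.\<close>
  also have "\<dots> = (\<integral>\<^sup>+x. W x * indicator {1..exp 1} (N x)
        * (\<integral>\<^sup>+l. ?i l * ennreal (l powr (\<alpha> - 1)) * (?\<phi> (l *\<^sub>R x) * indicator D (l *\<^sub>R x)) \<partial>lborel) \<partial>lborel)"
    using ray by (intro nn_integral_cong) (auto simp: indicator_def)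
  also have "\<dots> = (\<integral>\<^sup>+x. W x * (?\<phi> x * indicator D x * indicator {x. 0 < N x} x) \<partial>lborel)"
    by (rule nn_integral_polar[symmetric]) measurable
  also have "\<dots> = (\<integral>\<^sup>+x. ?\<phi> x * indicator D x \<partial>\<mu>)"
    using D by (subst nn_integral_density) (auto simp: indicator_def intro!: nn_integral_cong)
  finally show ?thesis .
qed

section \<open>Power law for \<open>B t\<close>, and null sets from dilations\<close>

lemma emeasure_B:
  assumes t: "0 < t"
  shows "emeasure \<mu> (B t) = ennreal (t powr \<alpha>) * emeasure \<mu> (B 1)"
proof -
  have "(\<lambda>x. (1 / t) *\<^sub>R x) -` B 1 = B t"
    using t by (auto simp: B_def N_scaleR field_simps)
  then show ?thesis
    using emeasure_scaleR[of "B 1" "1 / t"] t by (simp add: powr_minus powr_divide)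
qed

text \<open>Since \<open>\<alpha> < 0\<close>, a set of positive measure gets arbitrarily large measure when it is shrunk towards the origin.\<close>

lemma null_if_dilations_subset:
  assumes [measurable]: "E \<in> sets borel" "C \<in> sets borel"
    and fin: "emeasure \<mu> C < \<infinity>"
    and sub: "\<And>c x. 0 < c \<Longrightarrow> c \<le> 1 \<Longrightarrow> x \<in> E \<Longrightarrow> c *\<^sub>R x \<in> C"
  shows "emeasure \<mu> E = 0"
proof (rule ccontr)
  assume E0: "emeasure \<mu> E \<noteq> 0"
  have [measurable]: "(\<lambda>x. c *\<^sub>R x) -` C \<in> sets borel" for c
    using measurable_sets[of "\<lambda>x::'a. c *\<^sub>R x" borel borel C] by simp
  have *: "emeasure \<mu> E \<le> ennreal (c powr - \<alpha>) * emeasure \<mu> C" if "0 < c" "c \<le> 1" for c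
    using that sub by (subst emeasure_scaleR[symmetric]) (auto intro!: emeasure_mono)
  have Efin: "emeasure \<mu> E < \<infinity>"
    using *[of 1] fin by (simp add: order.strict_trans1)
  define a where "a = enn2real (emeasure \<mu> E)"
  define b where "b = enn2real (emeasure \<mu> C)"
  have ab: "emeasure \<mu> E = ennreal a" "emeasure \<mu> C = ennreal b" "0 \<le> a" "0 \<le> b"
    using Efin fin by (auto simp: a_def b_def)
  have "0 < a" using E0 ab by (cases "a = 0") auto
  have le: "a \<le> c powr - \<alpha> * b" if "0 < c" "c \<le> 1" for c
    using *[OF that] ab by (simp add: ennreal_mult[symmetric])
  \<comment> \<open>Since \<open>- \<alpha>\<close> is positive, the upper bound for
    \<open>a\<close> tends to 0 with \<open>c\<close>, contradicting \<open>0 < a\<close>.\<close>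
  have "((\<lambda>c. c powr - \<alpha> * b) \<longlongrightarrow> 0 powr - \<alpha> * b) (at_right 0)"
  proof (intro tendsto_mult tendsto_const tendsto_powr' disjI2 conjI)
    show "\<forall>\<^sub>F c in at_right (0::real). 0 \<le> c"
      by (rule eventually_mono[OF eventually_at_right_less]) simp
  qed (use \<alpha>_neg in \<open>auto intro: tendsto_ident_at\<close>)
  moreover have "\<forall>\<^sub>F c in at_right (0::real). a \<le> c powr - \<alpha> * b"
    using eventually_at_right_real[OF zero_less_one] by (rule eventually_mono) (use le in auto)
  ultimately have "a \<le> 0 powr - \<alpha> * b"
    by (intro tendsto_lowerbound) auto
  then show False using \<open>0 < a\<close> by simp
qed

section \<open>Minkowski enlargements and what they leave uncovered\<close>

definition enlarge :: "real \<Rightarrow> 'a set \<Rightarrow> 'a set" where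
  "enlarge \<epsilon> A = A + (\<lambda>x. \<epsilon> *\<^sub>R x) ` open_unit_ball N"

lemma mem_enlarge_iff:
  assumes e: "0 < \<epsilon>"
  shows "x \<in> enlarge \<epsilon> A \<longleftrightarrow> (\<exists>a\<in>A. N (x - a) < \<epsilon>)"
proof
  assume "x \<in> enlarge \<epsilon> A"
  then show "\<exists>a\<in>A. N (x - a) < \<epsilon>"
    using e by (force simp: enlarge_def set_plus_def open_unit_ball_def N_scaleR)
next
  assume "\<exists>a\<in>A. N (x - a) < \<epsilon>"
  then obtain a where a: "a \<in> A" "N (x - a) < \<epsilon>" by blast
  have "x = a + \<epsilon> *\<^sub>R ((1 / \<epsilon>) *\<^sub>R (x - a))" using e by simp
  moreover have "N ((1 / \<epsilon>) *\<^sub>R (x - a)) < 1"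
    using a e by (simp add: N_scaleR)
  ultimately show "x \<in> enlarge \<epsilon> A"
    using a(1) unfolding enlarge_def set_plus_def open_unit_ball_def by blast
qed

text \<open>A Minkowski sum with an open ball is a union of open translates, hence open, whatever
  \<open>A\<close> is.\<close>

lemma enlarge_measurable:
  assumes "0 < \<epsilon>"
  shows "enlarge \<epsilon> A \<in> sets borel"
proof -
  have "open (\<Union>a\<in>A. {x. N (x - a) < \<epsilon>})"
    by (intro open_UN ballI open_Collect_less continuous_intros
        continuous_on_compose2[OF semi_norm_continuous_on[OF semi_norm, of UNIV]]) auto
  moreover have "enlarge \<epsilon> A = (\<Union>a\<in>A. {x. N (x - a) < \<epsilon>})"
    using assms by (auto simp: mem_enlarge_iff)
  ultimately show ?thesis by simp
qed

text \<open>The difference of \<open>x\<close> and \<open>c *\<^sub>R x\<close> is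
  \<open>(1 - c) *\<^sub>R x\<close>, of size less than \<open>\<epsilon>\<close>; if
  \<open>c *\<^sub>R x\<close> were outside \<open>C\<close>, then \<open>x\<close> would lie in the
  enlargement of \<open>- C\<close>.\<close>

lemma radial_mem_if_not_enlarge:
  assumes x: "x \<notin> enlarge \<epsilon> (- C)" and "0 < \<epsilon>" "c \<le> 1" "(1 - c) * N x < \<epsilon>"
  shows "c *\<^sub>R x \<in> C"
proof -
  have "x - c *\<^sub>R x = (1 - c) *\<^sub>R x" by (simp add: scaleR_left_diff_distrib)
  then have "N (x - c *\<^sub>R x) < \<epsilon>"
    using assms by (simp add: N_scaleR)
  then show ?thesis using x assms(2) by (auto simp: mem_enlarge_iff)
qed

lemma enlarge_ball:
  assumes t: "0 < t" and e: "0 < \<epsilon>"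
  shows "enlarge \<epsilon> (- B t) = - B (t + \<epsilon>)"
proof (intro set_eqI iffI)
  fix x assume "x \<in> enlarge \<epsilon> (- B t)"
  then obtain a where "\<not> t \<le> N a" "N (x - a) < \<epsilon>"
    unfolding mem_enlarge_iff[OF e] B_def by blast
  then show "x \<in> - B (t + \<epsilon>)"
    using N_add[of a "x - a"] by (simp add: B_def)
next
  fix x assume "x \<in> - B (t + \<epsilon>)"
  then have x: "N x < t + \<epsilon>" by (simp add: B_def)
  \<comment> \<open>This factor splits \<open>t + \<epsilon>\<close> into \<open>t\<close> and
    \<open>\<epsilon>\<close>: \<open>N\<close> is below \<open>t\<close> at
    \<open>c *\<^sub>R x\<close> and below \<open>\<epsilon>\<close> at
    \<open>x - c *\<^sub>R x\<close>, so \<open>c *\<^sub>R x\<close> witnesses membership.\<close>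
  define c where "c = t / (t + \<epsilon>)"
  have c: "0 < c" "c < 1" "c * (t + \<epsilon>) = t" using t e by (auto simp: c_def)
  then have "(1 - c) * (t + \<epsilon>) = \<epsilon>" by (simp add: left_diff_distrib)
  then have "c * N x < t" "(1 - c) * N x < \<epsilon>"
    using mult_strict_left_mono[OF x, of c] mult_strict_left_mono[OF x, of "1 - c"] c by simp_all
  moreover have "c *\<^sub>R x \<notin> B t" if "c * N x < t"
    using that c by (simp add: B_def N_scaleR)
  ultimately show "x \<in> enlarge \<epsilon> (- B t)"
    using radial_mem_if_not_enlarge[of x \<epsilon> "B t" c] c e by (meson less_imp_le)
qed

text \<open>The radial shift treats only points with \<open>s < N x\<close>; this disposes of the
  others. If \<open>x\<close> is outside the enlargement and \<open>N x < \<epsilon>\<close>, then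
  \<open>c *\<^sub>R x\<close> lies in \<open>C\<close> whenever \<open>0 < c\<close> and
  \<open>c \<le> 1\<close>, so such points form a null set.\<close>

lemma emeasure_diff_enlarge_eq:
  assumes [measurable]: "C \<in> sets borel" and fin: "emeasure \<mu> C < \<infinity>" and e: "0 < \<epsilon>"
  shows "emeasure \<mu> (C - enlarge \<epsilon> (- C))
    = emeasure \<mu> {x \<in> C - enlarge \<epsilon> (- C). \<epsilon> \<le> N x}"
proof -
  let ?E = "C - enlarge \<epsilon> (- C)"
  have [measurable]: "enlarge \<epsilon> (- C) \<in> sets borel" by (rule enlarge_measurable[OF e])
  have [measurable]: "?E \<in> sets borel"
    "{x \<in> ?E. \<epsilon> \<le> N x} \<in> sets borel" "{x \<in> ?E. N x < \<epsilon>} \<in> sets borel"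
    by measurable
  have "emeasure \<mu> {x \<in> ?E. N x < \<epsilon>} = 0"
  proof (rule null_if_dilations_subset[where C = C])
    fix c :: real and x assume c: "0 < c" "c \<le> 1" and x: "x \<in> {x \<in> ?E. N x < \<epsilon>}"
    have "(1 - c) * N x \<le> 1 * N x"
      using c N_nonneg by (intro mult_right_mono) auto
    then show "c *\<^sub>R x \<in> C"
      using x c e by (intro radial_mem_if_not_enlarge[of x \<epsilon>]) auto
  qed (use fin in auto)
  then have null: "{x \<in> ?E. N x < \<epsilon>} \<in> null_sets \<mu>"
    by (auto simp: null_sets_def)
  have "emeasure \<mu> ?E = emeasure \<mu> ({x \<in> ?E. \<epsilon> \<le> N x} \<union> {x \<in> ?E. N x < \<epsilon>})"
    by (rule arg_cong[where f = "emeasure \<mu>"]) auto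
  also have "\<dots> = emeasure \<mu> {x \<in> ?E. \<epsilon> \<le> N x}"
    by (rule emeasure_Un_null_set[OF _ null]) simp
  finally show ?thesis .
qed

text \<open>The inward shift moves a point by exactly \<open>s\<close>. As the ball is open,
  \<open>s < \<epsilon>\<close> must be strict for points outside the enlargement to land in
  \<open>C\<close>.\<close>

lemma emeasure_diff_enlarge_le_shift:
  assumes [measurable]: "C \<in> sets borel" and fin: "emeasure \<mu> C < \<infinity>"
    and le: "emeasure \<mu> C \<le> emeasure \<mu> (B t)" and t: "0 < t" and s: "0 < s" "s < \<epsilon>"
  shows "emeasure \<mu> (C - enlarge \<epsilon> (- C)) \<le> emeasure \<mu> (B (t + s))"
proof -
  let ?E = "C - enlarge \<epsilon> (- C)"
  \<comment> \<open>Where \<open>N x = 0\<close>, division by zero would give \<open>?\<phi>\<close>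
    the value 1 instead of its limit 0, so these points are removed.\<close>
  let ?D = "{x \<in> C. 0 < N x}"
  let ?\<phi> = "\<lambda>x. ennreal ((1 + s / N x) powr (\<alpha> - 1))"
  have e: "0 < \<epsilon>" using s by simp
  have [measurable]: "?D \<in> sets borel" by measurable
  have "{x. s < N x \<and> (1 - s / N x) *\<^sub>R x \<in> ?D} \<in> sets borel" by measurable
  moreover have "{x \<in> ?E. \<epsilon> \<le> N x} \<subseteq> {x. s < N x \<and> (1 - s / N x) *\<^sub>R x \<in> ?D}"
  proof safe
    fix x assume x: "x \<in> C" "x \<notin> enlarge \<epsilon> (- C)" "\<epsilon> \<le> N x"
    show "s < N x" using x s by simp
    then have "0 < 1 - s / N x" "0 < N x" "1 - s / N x \<le> 1" using s by auto
    then show "(1 - s / N x) *\<^sub>R x \<in> C" "0 < N ((1 - s / N x) *\<^sub>R x)"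
      using x s e radial_mem_if_not_enlarge[OF x(2) e, of "1 - s / N x"]
      by (auto simp: N_scaleR)
  qed
  ultimately have "emeasure \<mu> ?E \<le> emeasure \<mu> {x. s < N x \<and> (1 - s / N x) *\<^sub>R x \<in> ?D}"
    unfolding emeasure_diff_enlarge_eq[OF assms(1) fin e] by (intro emeasure_mono) auto
  also have "\<dots> = (\<integral>\<^sup>+x. ?\<phi> x * indicator ?D x \<partial>\<mu>)"
    by (rule emeasure_radial_shift) (use s in auto)
  also have "\<dots> \<le> (\<integral>\<^sup>+x. ?\<phi> x * indicator (B t) x \<partial>\<mu>)"
  \<comment> \<open>\<open>k\<close> is the value of \<open>?\<phi>\<close> where
    \<open>N x = t\<close>; since \<open>\<alpha> - 1\<close> is negative, \<open>?\<phi>\<close>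
    increases with \<open>N x\<close>.\<close>
  proof (rule nn_integral_bathtub[where k = "ennreal ((1 + s / t) powr (\<alpha> - 1))"])
    have "emeasure \<mu> ?D \<le> emeasure \<mu> C" by (intro emeasure_mono) auto
    then show "emeasure \<mu> ?D < \<infinity>" "emeasure \<mu> ?D \<le> emeasure \<mu> (B t)"
      using fin le by auto
  next
    fix x assume "x \<in> ?D - B t"
    then have "0 < N x" "N x < t" by (auto simp: B_def)
    then show "?\<phi> x \<le> ennreal ((1 + s / t) powr (\<alpha> - 1))"
      using s t \<alpha>_neg
      by (intro ennreal_leI powr_mono2') (auto intro!: divide_left_mono add_pos_pos)
  next
    fix x assume "x \<in> B t"
    then have "t \<le> N x" by (auto simp: B_def)
    then show "ennreal ((1 + s / t) powr (\<alpha> - 1)) \<le> ?\<phi> x"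
      using s t \<alpha>_neg
      by (intro ennreal_leI powr_mono2') (auto intro!: divide_left_mono add_pos_pos)
  qed auto
  also have "\<dots> = emeasure \<mu> {x. s < N x \<and> (1 - s / N x) *\<^sub>R x \<in> B t}"
    by (rule emeasure_radial_shift[symmetric]) (use s t in \<open>auto simp: B_def\<close>)
  also have "{x. s < N x \<and> (1 - s / N x) *\<^sub>R x \<in> B t} = B (t + s)"
  proof -
    have "N ((1 - s / N x) *\<^sub>R x) = N x - s" if "s < N x" for x
      using that s by (simp add: N_scaleR field_simps)
    then show ?thesis using t s by (auto simp: B_def)
  qed
  finally show ?thesis .
qed

text \<open>Let \<open>s\<close> increase to \<open>\<epsilon>\<close> in the preceding bound; by
  the power law, the measure of \<open>B (t + s)\<close> is continuous in \<open>s\<close>.\<close>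

lemma emeasure_diff_enlarge_le:
  assumes C: "C \<in> sets borel" "emeasure \<mu> C < \<infinity>" "emeasure \<mu> C \<le> emeasure \<mu> (B t)"
    and t: "0 < t" and e: "0 < \<epsilon>"
  shows "emeasure \<mu> (C - enlarge \<epsilon> (- C)) \<le> emeasure \<mu> (B (t + \<epsilon>))"
proof -
  have "((\<lambda>s. ennreal ((t + s) powr \<alpha>) * emeasure \<mu> (B 1))
      \<longlongrightarrow> ennreal ((t + \<epsilon>) powr \<alpha>) * emeasure \<mu> (B 1)) (at_left \<epsilon>)"
    using t e by (intro tendsto_mult_ennreal tendsto_ennrealI tendsto_intros) (auto simp: ennreal_eq_0_iff)
  moreover have "\<forall>\<^sub>F s in at_left \<epsilon>. emeasure \<mu> (C - enlarge \<epsilon> (- C))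
      \<le> ennreal ((t + s) powr \<alpha>) * emeasure \<mu> (B 1)"
  proof -
    have "emeasure \<mu> (C - enlarge \<epsilon> (- C)) \<le> ennreal ((t + s) powr \<alpha>) * emeasure \<mu> (B 1)"
      if "0 < s" "s < \<epsilon>" for s
      using emeasure_diff_enlarge_le_shift[OF C t that] emeasure_B[of "t + s"] t that by simp
    then show ?thesis
      unfolding eventually_at_left_field using e by blast
  qed
  ultimately have "emeasure \<mu> (C - enlarge \<epsilon> (- C)) \<le> ennreal ((t + \<epsilon>) powr \<alpha>) * emeasure \<mu> (B 1)"
    by (intro tendsto_lowerbound) auto
  then show ?thesis using emeasure_B[of "t + \<epsilon>"] t e by simp
qed

section \<open>Inner boundary measure: comparison, exact value, lower bound\<close>

lemma inner_minkowski_enlarge: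
  "inner_minkowski \<mu> N C
    = Liminf (at_right 0) (\<lambda>\<epsilon>. emeasure \<mu> (enlarge \<epsilon> (- C) - (- C)) / ennreal \<epsilon>)"
  by (simp add: inner_minkowski_def enlarge_def Let_def)

text \<open>The comparison holds for each \<open>\<epsilon>\<close> before the limit. The boundary
  layer of \<open>C\<close> is \<open>C\<close> minus its uncovered core, and among sets of this
  measure \<open>B t\<close> has the largest core, \<open>B (t + \<epsilon>)\<close>. Finite measure
  permits the subtraction.\<close>

lemma inner_minkowski_B_le:
  assumes [measurable]: "C \<in> sets borel" and fin: "emeasure \<mu> C < \<infinity>"
    and eq: "emeasure \<mu> C = emeasure \<mu> (B t)" and t: "0 < t"
  shows "inner_minkowski \<mu> N (B t) \<le> inner_minkowski \<mu> N C"
  unfolding inner_minkowski_enlarge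
proof (intro Liminf_mono eventually_mono[OF eventually_at_right_less] divide_right_mono_ennreal)
  fix \<epsilon> :: real assume e: "0 < \<epsilon>"
  have [measurable]: "enlarge \<epsilon> (- C) \<in> sets borel" by (rule enlarge_measurable[OF e])
  have sub: "C - enlarge \<epsilon> (- C) \<subseteq> C" "B (t + \<epsilon>) \<subseteq> B t"
    using e by (auto simp: B_def)
  have lt: "emeasure \<mu> (C - enlarge \<epsilon> (- C)) \<noteq> \<infinity>" "emeasure \<mu> (B (t + \<epsilon>)) \<noteq> \<infinity>"
    using emeasure_mono[OF sub(1), of \<mu>] emeasure_mono[OF sub(2), of \<mu>] fin eq
    by (auto simp: top_unique)
  have "enlarge \<epsilon> (- B t) - - B t = B t - B (t + \<epsilon>)"
    by (auto simp: enlarge_ball[OF t e])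
  then have "emeasure \<mu> (enlarge \<epsilon> (- B t) - - B t) = emeasure \<mu> (B t) - emeasure \<mu> (B (t + \<epsilon>))"
    using lt sub by (simp add: emeasure_Diff)
  also have "\<dots> \<le> emeasure \<mu> C - emeasure \<mu> (C - enlarge \<epsilon> (- C))"
    unfolding eq using emeasure_diff_enlarge_le[OF _ fin _ t e] eq by (intro ennreal_minus_mono) auto
  also have "\<dots> = emeasure \<mu> (C - (C - enlarge \<epsilon> (- C)))"
    using lt sub by (subst emeasure_Diff) auto
  also have "C - (C - enlarge \<epsilon> (- C)) = enlarge \<epsilon> (- C) - - C" by auto
  finally show "emeasure \<mu> (enlarge \<epsilon> (- B t) - - B t) \<le> emeasure \<mu> (enlarge \<epsilon> (- C) - - C)" .
qed

text \<open>The layer of \<open>B t\<close> is \<open>B t - B (t + \<epsilon>)\<close>, so the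
  quotient is minus the difference quotient of \<open>m * r powr \<alpha>\<close> at
  \<open>r = t\<close>, and the lower limit is a derivative.\<close>

lemma inner_minkowski_B:
  assumes m: "emeasure \<mu> (B 1) = ennreal m" "0 \<le> m" and t: "0 < t"
  shows "inner_minkowski \<mu> N (B t) = ennreal (- \<alpha> * m * t powr (\<alpha> - 1))"
proof -
  let ?f = "\<lambda>\<epsilon>. (m * t powr \<alpha> - m * (t + \<epsilon>) powr \<alpha>) / \<epsilon>"
  have eB: "emeasure \<mu> (B r) = ennreal (m * r powr \<alpha>)" if "0 < r" for r
    using emeasure_B[OF that] m by (simp add: ennreal_mult[symmetric] mult.commute)
  have quot: "emeasure \<mu> (enlarge \<epsilon> (- B t) - - B t) / ennreal \<epsilon> = ennreal (?f \<epsilon>)" if e: "0 < \<epsilon>" for \<epsilon>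
  proof -
    have "enlarge \<epsilon> (- B t) - - B t = B t - B (t + \<epsilon>)"
      by (auto simp: enlarge_ball[OF t e])
    moreover have "B (t + \<epsilon>) \<subseteq> B t" using e by (auto simp: B_def)
    moreover have "m * (t + \<epsilon>) powr \<alpha> \<le> m * t powr \<alpha>"
      using e t \<alpha>_neg m by (intro mult_left_mono powr_mono2') auto
    ultimately show ?thesis
      using eB t e m by (simp add: emeasure_Diff ennreal_minus divide_ennreal)
  qed
  have "((\<lambda>r. m * r powr \<alpha>) has_real_derivative m * (\<alpha> * t powr (\<alpha> - 1))) (at t)"
    using t by (auto intro!: derivative_eq_intros)
  then have "((\<lambda>\<epsilon>. (m * (t + \<epsilon>) powr \<alpha> - m * t powr \<alpha>) / \<epsilon>) \<longlongrightarrow> m * (\<alpha> * t powr (\<alpha> - 1))) (at 0)"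
    by (simp add: DERIV_def)
  then have "((\<lambda>\<epsilon>. - ((m * (t + \<epsilon>) powr \<alpha> - m * t powr \<alpha>) / \<epsilon>)) \<longlongrightarrow> - (m * (\<alpha> * t powr (\<alpha> - 1)))) (at_right 0)"
    by (intro tendsto_minus) (auto intro: filterlim_mono[OF _ order_refl at_le])
  then have "(?f \<longlongrightarrow> - \<alpha> * m * t powr (\<alpha> - 1)) (at_right 0)"
    by (simp add: minus_divide_left mult_ac)
  then have "((\<lambda>\<epsilon>. ennreal (?f \<epsilon>)) \<longlongrightarrow> ennreal (- \<alpha> * m * t powr (\<alpha> - 1))) (at_right 0)"
    by (rule tendsto_ennrealI)
  then have "((\<lambda>\<epsilon>. emeasure \<mu> (enlarge \<epsilon> (- B t) - - B t) / ennreal \<epsilon>)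
      \<longlongrightarrow> ennreal (- \<alpha> * m * t powr (\<alpha> - 1))) (at_right 0)"
    by (rule Lim_transform_eventually)
       (auto intro!: eventually_mono[OF eventually_at_right_less] simp: quot simp del: Diff_Compl)
  then show ?thesis
    unfolding inner_minkowski_enlarge by (intro lim_imp_Liminf) auto
qed

lemma inner_minkowski_B_eq:
  assumes m: "emeasure \<mu> (B 1) < \<infinity>" and t: "0 < t" and q: "\<alpha> = 1 / q"
  shows "inner_minkowski \<mu> N (B t)
    = ennreal (- 1 / q) * epow (emeasure \<mu> (B 1)) q * epow (emeasure \<mu> (B t)) (1 - q)"
proof -
  define m where "m = enn2real (emeasure \<mu> (B 1))"
  have m: "emeasure \<mu> (B 1) = ennreal m" "0 \<le> m" using m by (auto simp: m_def)
  have q0: "q < 0" using \<alpha>_neg q by simp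
  have eB: "emeasure \<mu> (B t) = ennreal (m * t powr \<alpha>)"
    using emeasure_B[OF t] m by (simp add: ennreal_mult[symmetric] mult.commute)
  show ?thesis
  proof (cases "m = 0")
    case True
    \<comment> \<open>Both sides are 0: \<open>epow 0 q\<close> is infinite, but
      \<open>epow 0 (1 - q)\<close> is 0 and infinity times 0 is 0.\<close>
    then show ?thesis
      using inner_minkowski_B[OF m t] q0 by (simp add: eB epow_def)
  next
    case False
    then have m0: "0 < m" using m by simp
    \<comment> \<open>The powers of \<open>m\<close> add up to 1, and
      \<open>\<alpha> * q = 1\<close> turns \<open>\<alpha> * (1 - q)\<close> into
      \<open>\<alpha> - 1\<close>.\<close>
    have "m powr q * (m * t powr \<alpha>) powr (1 - q) = m powr (q + (1 - q)) * t powr (\<alpha> * (1 - q))"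
      using m0 t by (simp only: powr_mult powr_powr powr_add mult.assoc)
    also have "\<dots> = m * t powr (\<alpha> - 1)"
      using m0 q q0 by (simp add: field_simps)
    finally have "- \<alpha> * m * t powr (\<alpha> - 1) = - 1 / q * (m powr q * (m * t powr \<alpha>) powr (1 - q))"
      using q by simp
    moreover have "0 \<le> - 1 / q" using q0 by (simp add: divide_nonpos_neg)
    ultimately have "ennreal (- \<alpha> * m * t powr (\<alpha> - 1))
        = ennreal (- 1 / q) * ennreal (m powr q) * ennreal ((m * t powr \<alpha>) powr (1 - q))"
      by (simp only: ennreal_mult powr_ge_zero mult_nonneg_nonneg mult.assoc)
    moreover have "epow (ennreal r) a = ennreal (r powr a)" if "0 < r" "a \<noteq> 0" for r a
      using that by (simp add: epow_def)
    then have "epow (ennreal m) q = ennreal (m powr q)"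
      "epow (ennreal (m * t powr \<alpha>)) (1 - q) = ennreal ((m * t powr \<alpha>) powr (1 - q))"
      using m0 q0 t by simp_all
    ultimately show ?thesis
      unfolding inner_minkowski_B[OF m t] eB m(1) by (simp only:)
  qed
qed

lemma inner_minkowski_ge:
  assumes m: "emeasure \<mu> (B 1) < \<infinity>" and q: "\<alpha> = 1 / q"
    and C [measurable]: "C \<in> sets borel" and fin: "emeasure \<mu> C < \<infinity>"
  shows "ennreal (- 1 / q) * epow (emeasure \<mu> (B 1)) q * epow (emeasure \<mu> C) (1 - q)
    \<le> inner_minkowski \<mu> N C"
proof -
  define m where "m = enn2real (emeasure \<mu> (B 1))"
  define b where "b = enn2real (emeasure \<mu> C)"
  have m: "emeasure \<mu> (B 1) = ennreal m" "0 \<le> m"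
    and b: "emeasure \<mu> C = ennreal b" "0 \<le> b" using m fin by (auto simp: m_def b_def)
  have q0: "q < 0" using \<alpha>_neg q by simp
  \<comment> \<open>The bound is 0 if \<open>b = 0\<close> and infinite if \<open>m = 0 < b\<close>;
    otherwise \<open>C\<close> is compared with some \<open>B t\<close> of equal measure.\<close>
  consider "b = 0" | "0 < b" "m = 0" | "0 < b" "0 < m" using m b by fastforce
  then show ?thesis
  proof cases
    case 1
    then show ?thesis using b q0 by (simp add: epow_def)
  next
    case 2
    \<comment> \<open>Every \<open>B \<epsilon>\<close> is null here, so any enlargement covers
      almost all of \<open>C\<close>, and the quotient \<open>b / \<epsilon>\<close>
      diverges.\<close>
    have "emeasure \<mu> (enlarge \<epsilon> (- C) - - C) = ennreal b" if e: "0 < \<epsilon>" for \<epsilon>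
    proof -
      have [measurable]: "enlarge \<epsilon> (- C) \<in> sets borel" by (rule enlarge_measurable[OF e])
      have "emeasure \<mu> {x \<in> C - enlarge \<epsilon> (- C). \<epsilon> \<le> N x} \<le> emeasure \<mu> (B \<epsilon>)"
        by (intro emeasure_mono) (auto simp: B_def)
      also have "\<dots> = 0" using emeasure_B[OF e] m 2 by simp
      finally have "C - enlarge \<epsilon> (- C) \<in> null_sets \<mu>"
        using emeasure_diff_enlarge_eq[OF C fin e] by (auto simp: null_sets_def)
      moreover have "enlarge \<epsilon> (- C) - - C = C - (C - enlarge \<epsilon> (- C))" by auto
      ultimately show ?thesis
        using b by (simp add: emeasure_Diff_null_set)
    qed
    then have "inner_minkowski \<mu> N C = Liminf (at_right 0) (\<lambda>\<epsilon>. ennreal b / ennreal \<epsilon>)"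
      unfolding inner_minkowski_enlarge
      by (intro Liminf_eq eventually_mono[OF eventually_at_right_less]) auto
    also have "\<dots> = \<infinity>"
    proof (intro lim_imp_Liminf)
      have "filterlim (\<lambda>\<epsilon>. b / \<epsilon>) at_top (at_right 0)"
        using filterlim_tendsto_pos_mult_at_top[OF tendsto_const _ filterlim_inverse_at_top_right, of b] 2
        by (simp add: divide_inverse)
      then have "((\<lambda>\<epsilon>. ennreal (b / \<epsilon>)) \<longlongrightarrow> \<infinity>) (at_right 0)"
        by (simp add: ennreal_tendsto_top_eq_at_top)
      then show "((\<lambda>\<epsilon>. ennreal b / ennreal \<epsilon>) \<longlongrightarrow> \<infinity>) (at_right 0)"
        by (rule Lim_transform_eventually)
           (use b in \<open>auto intro!: eventually_mono[OF eventually_at_right_less] simp: divide_ennreal\<close>)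
    qed simp
    finally show ?thesis by simp
  next
    case 3
    \<comment> \<open>The solution of \<open>m * t powr (1 / q) = b\<close>.\<close>
    define t where "t = (b / m) powr q"
    have t: "0 < t" using 3 by (simp add: t_def)
    have "t powr \<alpha> = b / m"
      using 3 q q0 by (simp add: t_def powr_powr)
    then have eq: "emeasure \<mu> C = emeasure \<mu> (B t)"
      using emeasure_B[OF t] m b 3 by (simp add: ennreal_mult[symmetric])
    then show ?thesis
      using inner_minkowski_B_le[OF C fin eq t] inner_minkowski_B_eq[OF _ t q] m by simp
  qed
qed

end

section \<open>From p-homogeneous weights to the theorem\<close>

lemma p_homogeneous_imp:
  assumes hom: "p_homogeneous p w" and p: "p < 0"
    and nonneg: "\<And>x. x \<noteq> 0 \<Longrightarrow> 0 \<le> w x" and x: "x \<noteq> 0" and c: "0 < c"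
  shows "w (c *\<^sub>R x) = c powr (1 / p) * w x"
proof -
  have eq: "epow (ennreal (w (c *\<^sub>R x))) p = ennreal c * epow (ennreal (w x)) p"
    using hom x c by (auto simp: p_homogeneous_def)
  have 0: "0 \<le> w x" "0 \<le> w (c *\<^sub>R x)" using nonneg x c by auto
  \<comment> \<open>The power is infinite exactly at 0, so \<open>w\<close> vanishes at
    \<open>x\<close> and at \<open>c *\<^sub>R x\<close> together; otherwise both powers are finite
    and the exponent \<open>1 / p\<close> undoes them.\<close>
  have top: "epow (ennreal r) p = (if r = 0 then \<infinity> else ennreal (r powr p))" if "0 \<le> r" for r
    using that p by (simp add: epow_def)
  show ?thesis
  proof (cases "w x = 0")
    case True
    then have "w (c *\<^sub>R x) = 0"
      using eq 0 c by (auto simp: epow_def ennreal_mult_top p split: if_splits)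
    then show ?thesis using True by simp
  next
    case False
    then have "w (c *\<^sub>R x) \<noteq> 0" and "(w (c *\<^sub>R x)) powr p = c * w x powr p"
      using eq 0 c by (auto simp: top ennreal_mult[symmetric] split: if_splits)
    then have "((w (c *\<^sub>R x)) powr p) powr (1 / p) = (c * w x powr p) powr (1 / p)" by simp
    then show ?thesis
      using 0 p c False \<open>w (c *\<^sub>R x) \<noteq> 0\<close> by (simp add: powr_powr powr_mult)
  qed
qed

theorem theorem1p3:
  fixes w :: "real ^ 'n \<Rightarrow> real"
    and N :: "real ^ 'n \<Rightarrow> real"
    and p q :: real
  defines "K \<equiv> open_unit_ball N"
    and "\<mu> \<equiv> weighted_measure w"
  assumes p: "p \<in> {- 1 / real CARD('n) <..< 0}"
    and q: "q < 0" "1 / q = 1 / p + real CARD('n)"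
    and w_nonneg: "\<And>x. x \<noteq> 0 \<Longrightarrow> 0 \<le> w x"
    and w_borel: "w \<in> borel_measurable (restrict_space borel (- {0}))"
    and w_hom: "p_homogeneous p w"
    and N: "semi_norm N"
    and fin: "emeasure \<mu> (- K) < \<infinity>"
  shows "(\<forall>C \<in> sets borel. emeasure \<mu> C < \<infinity> \<longrightarrow>
            inner_minkowski \<mu> N C
              \<ge> ennreal (- 1 / q) * epow (emeasure \<mu> (- K)) q * epow (emeasure \<mu> C) (1 - q))
       \<and> (\<forall>t > 0. inner_minkowski \<mu> N (- ((\<lambda>x. t *\<^sub>R x) ` K))
              = ennreal (- 1 / q) * epow (emeasure \<mu> (- K)) q
                  * epow (emeasure \<mu> (- ((\<lambda>x. t *\<^sub>R x) ` K))) (1 - q))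
       \<and> (\<forall>t > 0. isoperimetric_minimizer \<mu> N (- ((\<lambda>x. t *\<^sub>R x) ` K)))"
proof -
  let ?W = "\<lambda>x. if x = 0 then 0 else ennreal (w x)"
  have p0: "p < 0" using p by simp
  interpret homogeneous_weight ?W N "1 / q"
  proof
    \<comment> \<open>The value 0 at the origin extends \<open>w\<close> to a Borel function on the
      whole space and respects homogeneity.\<close>
    have "(\<lambda>x. if x \<in> - {0} then w x else 0) \<in> borel_measurable borel"
      using w_borel by (subst measurable_restrict_space_iff[symmetric]) auto
    then have "(\<lambda>x. ennreal (if x \<in> - {0} then w x else 0)) \<in> borel_measurable borel"
      by measurable
    also have "(\<lambda>x. ennreal (if x \<in> - {0} then w x else 0)) = ?W" by auto
    finally show "?W \<in> borel_measurable borel" .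
  next
    fix c :: real and x :: "real ^ 'n"
    assume "0 < c"
    then show "?W (c *\<^sub>R x) = ennreal (c powr (1 / q - DIM(real ^ 'n))) * ?W x"
      using p_homogeneous_imp[OF w_hom p0 w_nonneg, of x c] w_nonneg
      by (simp add: q(2) ennreal_mult)
  qed (use N q(1) in auto)
  have \<mu>: "\<mu> = density lborel ?W"
    by (simp add: \<mu>_def weighted_measure_def)
  have ball: "- ((\<lambda>x. t *\<^sub>R x) ` K) = B t" if "0 < t" for t
  proof -
    have "x \<in> (\<lambda>x. t *\<^sub>R x) ` K \<longleftrightarrow> N x < t" for x
    proof
      assume "N x < t"
      then have "(1 / t) *\<^sub>R x \<in> K" "x = t *\<^sub>R (1 / t) *\<^sub>R x"
        using that by (auto simp: K_def open_unit_ball_def N_scaleR)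
      then show "x \<in> (\<lambda>x. t *\<^sub>R x) ` K" by blast
    qed (use that in \<open>auto simp: K_def open_unit_ball_def N_scaleR\<close>)
    then show ?thesis by (simp add: set_eq_iff B_def not_less)
  qed
  have K: "- K = B 1" using ball[of 1] by simp
  have fin1: "emeasure \<mu> (B 1) < \<infinity>" using fin K by simp
  have finB: "emeasure \<mu> (B t) < \<infinity>" if "0 < t" for t
    using emeasure_B[OF that] fin1 by (simp add: \<mu> ennreal_mult_less_top)
  have ge: "ennreal (- 1 / q) * epow (emeasure \<mu> (- K)) q * epow (emeasure \<mu> C) (1 - q)
      \<le> inner_minkowski \<mu> N C" if "C \<in> sets borel" "emeasure \<mu> C < \<infinity>" for C
    using inner_minkowski_ge[of q C] fin1 that by (simp add: K \<mu>)
  have eq: "inner_minkowski \<mu> N (B t)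
      = ennreal (- 1 / q) * epow (emeasure \<mu> (- K)) q * epow (emeasure \<mu> (B t)) (1 - q)"
    if "0 < t" for t
    using inner_minkowski_B_eq[of t q] fin1 that by (simp add: K \<mu>)
  \<comment> \<open>The lower bound depends on a set only through its measure, and
    \<open>B t\<close>, of finite measure, attains it.\<close>
  have "isoperimetric_minimizer \<mu> N (B t)" if "0 < t" for t
    unfolding isoperimetric_minimizer_def
  proof (intro conjI ballI impI)
    fix D :: "(real ^ 'n) set"
    assume "D \<in> sets borel" "emeasure \<mu> D = emeasure \<mu> (B t)"
    then show "inner_minkowski \<mu> N (B t) \<le> inner_minkowski \<mu> N D"
      using ge[of D] finB[OF that] unfolding eq[OF that] by (simp only:)
  qed simp
  then show ?thesis
    using ge eq by (simp add: ball)
qed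

end
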